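(* Let $B$ be a left semi-brace. Then $B^{n}$ is a left ideal of $B$ for every positive integer $n$, where $B^1=B$ and $B^{n+1}=B\cdot B^n+E$ is the left series of $B$.
   Context: A left semi-brace is a set $B$ with two operations $+$ and $\circ$ such that $(B,+)$ is a left cancellative semigroup (not necessarily commutative), $(B,\circ)$ is a group, and $a\circ(b+c)=a\circ b+a\circ(a^-+c)$ for all $a,b,c\in B$, where $a^-$ is the inverse of $a$ in $(B,\circ)$ and $\circ$ has higher precedence than $+$. The identity of $(B,\circ)$ is denoted $0$; it is an idempotent and a left identity of $(B,+)$. Let $E$ be the set of idempotents of $(B,+)$ and $G=B+0=\{b+0: b\in B\}$, which is a subgroup of $(B,+)$ (with identity $0$). For $a,b\in B$ put $\lambda_a(b)=a\circ(a^-+b)$ and define the operation $a\cdot b=\lambda_a(a^-)+a\circ b+\lambda_b(b^-)$; one has $a\cdot b\in G$. For subsets $X,Y\subseteq B$, $X\cdot Y$ denotes the subgroup of $(G,+)$ generated by all $x\cdot y$ with $x\in X$, $y\in Y$, and $X+Y=\{x+y:x\in X,y\in Y\}$. A subset $I$ of $B$ is a left ideal of $B$ if: (1) $I+0\subseteq I$; (2) $I\cap G$ is a subgroup of $(G,+)$; (3) $\lambda_g(I)\subseteq I$ for every $g\in G$; (4) $I$ is a subgroup of $(B,\circ)$. *)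

theory Defs
  imports "HOL-Algebra.Generated_Groups"
begin

text \<open>
  The inherited monoid part of the record is the multiplicative structure \<open>(B, \<circ>)\<close>, written
  \<open>\<otimes>\<close>. Its unit \<open>\<one>\<close> is the element usually denoted \<open>0\<close> in the
  theory of semi-braces. The addition is written \<open>\<oplus>\<close>.
\<close>

record 'a semi_brace = "'a monoid" +
  sadd :: "['a, 'a] \<Rightarrow> 'a" (infixl \<open>\<oplus>\<index>\<close> 65)

locale left_semi_brace = group B for B (structure) +
  assumes sadd_closed:
      "\<lbrakk>a \<in> carrier B; b \<in> carrier B\<rbrakk> \<Longrightarrow> a \<oplus> b \<in> carrier B"
    and sadd_assoc:
      "\<lbrakk>a \<in> carrier B; b \<in> carrier B; c \<in> carrier B\<rbrakk>
        \<Longrightarrow> (a \<oplus> b) \<oplus> c = a \<oplus> (b \<oplus> c)"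
    and sadd_left_cancel:
      "\<lbrakk>a \<in> carrier B; b \<in> carrier B; c \<in> carrier B; a \<oplus> b = a \<oplus> c\<rbrakk>
        \<Longrightarrow> b = c"
    and mult_sadd:
      "\<lbrakk>a \<in> carrier B; b \<in> carrier B; c \<in> carrier B\<rbrakk>
        \<Longrightarrow> a \<otimes> (b \<oplus> c) = a \<otimes> b \<oplus> a \<otimes> (inv a \<oplus> c)"

definition set_sadd :: "('a, 'b) semi_brace_scheme \<Rightarrow> 'a set \<Rightarrow> 'a set \<Rightarrow> 'a set"
  where "set_sadd B X Y = {x \<oplus>\<^bsub>B\<^esub> y | x y. x \<in> X \<and> y \<in> Y}"

definition sb_idem :: "('a, 'b) semi_brace_scheme \<Rightarrow> 'a set"
  where "sb_idem B = {e \<in> carrier B. e \<oplus>\<^bsub>B\<^esub> e = e}"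

text \<open>The additive group \<open>G = B + 0\<close>, whose identity is the identity of \<open>(B, \<circ>)\<close>.\<close>

definition add_group :: "('a, 'b) semi_brace_scheme \<Rightarrow> 'a monoid"
  where "add_group B =
    \<lparr>carrier = set_sadd B (carrier B) {\<one>\<^bsub>B\<^esub>}, mult = sadd B, one = \<one>\<^bsub>B\<^esub>\<rparr>"

definition sb_lambda :: "('a, 'b) semi_brace_scheme \<Rightarrow> 'a \<Rightarrow> 'a \<Rightarrow> 'a"
  where "sb_lambda B a b = a \<otimes>\<^bsub>B\<^esub> (inv\<^bsub>B\<^esub> a \<oplus>\<^bsub>B\<^esub> b)"

definition sb_dot :: "('a, 'b) semi_brace_scheme \<Rightarrow> 'a \<Rightarrow> 'a \<Rightarrow> 'a"
  where "sb_dot B a b =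
    sb_lambda B a (inv\<^bsub>B\<^esub> a) \<oplus>\<^bsub>B\<^esub> a \<otimes>\<^bsub>B\<^esub> b \<oplus>\<^bsub>B\<^esub> sb_lambda B b (inv\<^bsub>B\<^esub> b)"

definition set_dot :: "('a, 'b) semi_brace_scheme \<Rightarrow> 'a set \<Rightarrow> 'a set \<Rightarrow> 'a set"
  where "set_dot B X Y = generate (add_group B) {sb_dot B x y | x y. x \<in> X \<and> y \<in> Y}"

definition left_ideal :: "('a, 'b) semi_brace_scheme \<Rightarrow> 'a set \<Rightarrow> bool"
  where "left_ideal B I \<longleftrightarrow>
    I \<subseteq> carrier B \<and>
    set_sadd B I {\<one>\<^bsub>B\<^esub>} \<subseteq> I \<and>
    subgroup (I \<inter> carrier (add_group B)) (add_group B) \<and>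
    (\<forall>g \<in> carrier (add_group B). sb_lambda B g ` I \<subseteq> I) \<and>
    subgroup I B"

text \<open>The series is indexed from 1; the value at index 0 is a dummy.\<close>

fun left_series :: "('a, 'b) semi_brace_scheme \<Rightarrow> nat \<Rightarrow> 'a set"
  where
    "left_series B 0 = {}"
  | "left_series B (Suc 0) = carrier B"
  | "left_series B (Suc (Suc n)) =
      set_sadd B (set_dot B (carrier B) (left_series B (Suc n))) (sb_idem B)"

end

theory Submission
  imports Defs
begin

text \<open>
  Write \<open>0\<close> for the identity of \<open>(B, \<circ>)\<close>, which is a left identity of \<open>(B, +)\<close>. The
  defining identity gives \<open>a \<circ> b = a + \<lambda>\<^sub>a(b)\<close>. In particular \<open>\<lambda>\<^sub>a(a\<^sup>-)\<close> is a right inverse of \<open>a\<close> with respect to \<open>0\<close>; hence \<open>G = B + 0\<close> is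
  a group, and the defining formula of the dot operation collapses to
  \<open>a \<cdot> b = \<lambda>\<^sub>a(b) - b\<close>, that is, \<open>\<lambda>\<^sub>a(b) + 0 = a \<cdot> b + (b + 0)\<close>.

  For a subgroup \<open>H\<close> of \<open>(G, +)\<close> the set \<open>J = H + E\<close> is the full preimage
  \<open>{b. b + 0 \<in> H}\<close> of \<open>H\<close> under the additive projection \<open>b \<mapsto> b + 0\<close>. If moreover \<open>H\<close>
  contains \<open>B \<cdot> J\<close>, then the formula for \<open>\<lambda>\<^sub>a(b) + 0\<close> shows that \<open>J\<close> is stable under all
  \<open>\<lambda>\<^sub>a\<close>, and then \<open>a \<circ> b = a + \<lambda>\<^sub>a(b)\<close> shows that \<open>J\<close> is closed under \<open>\<circ>\<close> and
  inverses; so \<open>J\<close> is a left ideal. For \<open>H = B \<cdot> B\<^sup>n\<close>, where \<open>J = B\<^bsup>n+1\<^esup>\<close>, the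
  requirement \<open>B \<cdot> J \<subseteq> H\<close> holds because the left series is decreasing, which follows by
  induction from the monotonicity of the dot product of subsets.
\<close>

context left_semi_brace
begin

abbreviation lam :: "'a \<Rightarrow> 'a \<Rightarrow> 'a"
  where "lam \<equiv> sb_lambda B"

text \<open>The additive right inverse \<open>\<lambda>\<^sub>a(a\<^sup>-)\<close> of \<open>a\<close>; it is the negative of \<open>a + 0\<close> in \<open>G\<close>.\<close>

abbreviation neg :: "'a \<Rightarrow> 'a"
  where "neg a \<equiv> lam a (inv a)"

lemma lam_closed [simp]:
  "a \<in> carrier B \<Longrightarrow> b \<in> carrier B \<Longrightarrow> lam a b \<in> carrier B"
  by (simp add: sb_lambda_def sadd_closed)

lemma one_sadd [simp]:
  assumes "c \<in> carrier B"
  shows "\<one> \<oplus> c = c"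
  using mult_sadd[of \<one> \<one> c] sadd_left_cancel[of \<one> c "\<one> \<oplus> c"] assms
  by (simp add: sadd_closed)

lemma mult_eq_sadd_lam:
  assumes "a \<in> carrier B" "b \<in> carrier B"
  shows "a \<otimes> b = a \<oplus> lam a b"
  using mult_sadd[of a \<one> b] assms by (simp add: sb_lambda_def)

lemma sadd_neg [simp]:
  "a \<in> carrier B \<Longrightarrow> a \<oplus> neg a = \<one>"
  using mult_eq_sadd_lam[of a "inv a"] by simp

lemma neg_sadd_one [simp]:
  assumes a: "a \<in> carrier B"
  shows "neg a \<oplus> \<one> = neg a"
proof (rule sadd_left_cancel)
  show "a \<oplus> (neg a \<oplus> \<one>) = a \<oplus> neg a"
    using a by (simp flip: sadd_assoc)
qed (use a in \<open>simp_all add: sadd_closed\<close>)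

text \<open>Idempotents of a left cancellative semigroup are left identities.\<close>

lemma idem_sadd:
  assumes "e \<in> sb_idem B" "x \<in> carrier B"
  shows "e \<oplus> x = x"
proof (rule sadd_left_cancel)
  show "e \<oplus> (e \<oplus> x) = e \<oplus> x"
    using assms sadd_assoc[of e e x] by (simp add: sb_idem_def)
qed (use assms in \<open>auto simp: sb_idem_def sadd_closed\<close>)

lemma neg_sadd_idem:
  assumes a: "a \<in> carrier B"
  shows "neg a \<oplus> a \<in> sb_idem B"
proof -
  have "(neg a \<oplus> a) \<oplus> (neg a \<oplus> a) = neg a \<oplus> ((a \<oplus> neg a) \<oplus> a)"
    using a by (simp add: sadd_assoc sadd_closed del: sadd_neg)
  then show ?thesis
    using a by (simp add: sb_idem_def sadd_closed)
qed

text \<open>The projection \<open>b \<mapsto> b + 0\<close> onto \<open>G\<close> is additive.\<close>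

lemma sadd_one_sadd:
  assumes "a \<in> carrier B" "b \<in> carrier B"
  shows "(a \<oplus> b) \<oplus> \<one> = (a \<oplus> \<one>) \<oplus> (b \<oplus> \<one>)"
  using assms by (simp add: sadd_assoc sadd_closed)

lemma add_group_simps:
  "carrier (add_group B) = {b \<oplus> \<one> | b. b \<in> carrier B}"
  "x \<otimes>\<^bsub>add_group B\<^esub> y = x \<oplus> y"
  "\<one>\<^bsub>add_group B\<^esub> = \<one>"
  by (auto simp: add_group_def set_sadd_def)

lemma carrier_add_group_iff:
  "x \<in> carrier (add_group B) \<longleftrightarrow> x \<in> carrier B \<and> x \<oplus> \<one> = x"
  by (force simp: add_group_simps sadd_closed sadd_assoc)

lemma group_add_group: "group (add_group B)"
proof (rule groupI)
  fix x assume x: "x \<in> carrier (add_group B)"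
  then have xB: "x \<in> carrier B" and x1: "x \<oplus> \<one> = x"
    by (simp_all add: carrier_add_group_iff)
  \<comment> \<open>An idempotent of the form \<open>u + 0\<close> equals \<open>0\<close>, so the right inverse is two-sided on \<open>G\<close>.\<close>
  have "neg x \<oplus> x = (neg x \<oplus> x) \<oplus> \<one>"
    using xB x1 by (simp add: sadd_assoc)
  also have "\<dots> = \<one>"
    using idem_sadd[OF neg_sadd_idem] xB by simp
  finally show "\<exists>y\<in>carrier (add_group B). y \<otimes>\<^bsub>add_group B\<^esub> x = \<one>\<^bsub>add_group B\<^esub>"
    using xB by (intro bexI[of _ "neg x"]) (simp_all add: carrier_add_group_iff add_group_simps(2,3))
qed (simp_all add: carrier_add_group_iff add_group_simps(2,3) sadd_closed sadd_assoc)

lemma sb_dot_eq: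
  assumes a: "a \<in> carrier B" and b: "b \<in> carrier B"
  shows "sb_dot B a b = lam a b \<oplus> neg b"
proof -
  have "sb_dot B a b = ((neg a \<oplus> a) \<oplus> lam a b) \<oplus> neg b"
    using a b by (simp add: sb_dot_def mult_eq_sadd_lam sadd_assoc sadd_closed)
  then show ?thesis
    using a b by (simp add: idem_sadd[OF neg_sadd_idem])
qed

lemma sb_dot_in_add_group:
  assumes "a \<in> carrier B" "b \<in> carrier B"
  shows "sb_dot B a b \<in> carrier (add_group B)"
  using assms by (simp add: sb_dot_eq carrier_add_group_iff sadd_closed sadd_assoc)

lemma lam_sadd_one:
  assumes a: "a \<in> carrier B" and b: "b \<in> carrier B"
  shows "lam a b \<oplus> \<one> = sb_dot B a b \<oplus> (b \<oplus> \<one>)"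
proof -
  have "neg b \<oplus> (b \<oplus> \<one>) = \<one>"
    using b idem_sadd[OF neg_sadd_idem[OF b], of \<one>] by (simp add: sadd_assoc)
  then show ?thesis
    using a b by (simp add: sb_dot_eq sadd_assoc sadd_closed)
qed

lemma set_sadd_idem_eq:
  assumes H: "subgroup H (add_group B)"
  shows "set_sadd B H (sb_idem B) = {b \<in> carrier B. b \<oplus> \<one> \<in> H}"
proof -
  have HG: "h \<in> carrier B \<and> h \<oplus> \<one> = h" if "h \<in> H" for h
    using subgroup.mem_carrier[OF H that] by (simp add: carrier_add_group_iff)
  show ?thesis
  proof (rule subset_antisym; rule subsetI)
    fix b assume "b \<in> set_sadd B H (sb_idem B)"
    then obtain h e where h: "h \<in> H" and e: "e \<in> sb_idem B" and b: "b = h \<oplus> e"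
      by (auto simp: set_sadd_def)
    have "b \<oplus> \<one> = h"
      using HG[OF h] e idem_sadd[OF e] by (simp add: b sb_idem_def sadd_assoc)
    then show "b \<in> {b \<in> carrier B. b \<oplus> \<one> \<in> H}"
      using HG[OF h] h e by (simp add: b sb_idem_def sadd_closed)
  next
    fix b assume "b \<in> {b \<in> carrier B. b \<oplus> \<one> \<in> H}"
    then have b: "b \<in> carrier B" and bH: "b \<oplus> \<one> \<in> H"
      by simp_all
    have "b = (b \<oplus> neg b) \<oplus> b"
      using b by simp
    also have "\<dots> = (b \<oplus> \<one>) \<oplus> (neg b \<oplus> b)"
      using b by (simp add: sadd_assoc sadd_closed del: sadd_neg)
    finally show "b \<in> set_sadd B H (sb_idem B)"
      using bH neg_sadd_idem[OF b] by (auto simp: set_sadd_def)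
  qed
qed

text \<open>
  The set \<open>J\<close> is \<open>H + E\<close> by the previous lemma. When \<open>H = B \<cdot> I\<close>, the
  assumption on the dot operation follows from \<open>J \<subseteq> I\<close>; that \<open>I\<close> itself is a left ideal
  plays no role.
\<close>

lemma left_ideal_preimage:
  assumes H: "subgroup H (add_group B)"
    and J: "J = {b \<in> carrier B. b \<oplus> \<one> \<in> H}"
    and dot: "\<And>a b. a \<in> carrier B \<Longrightarrow> b \<in> J \<Longrightarrow> sb_dot B a b \<in> H"
  shows "left_ideal B J"
proof -
  interpret G: group "add_group B"
    by (rule group_add_group)
  interpret H: subgroup H "add_group B"
    by (rule H)
  have plus_H: "x \<oplus> y \<in> H" if "x \<in> H" "y \<in> H" for x y
    using H.m_closed[OF that] by (simp add: add_group_simps)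
  have lam_J: "lam a b \<in> J" if "a \<in> carrier B" "b \<in> J" for a b
    using that dot[OF that] plus_H by (simp add: J lam_sadd_one)
  have J_G: "J \<inter> carrier (add_group B) = H"
    using H.mem_carrier by (auto simp: J carrier_add_group_iff)
  have "subgroup J B"
  proof (rule subgroupI)
    show "J \<subseteq> carrier B"
      by (auto simp: J)
    show "J \<noteq> {}"
      using H.one_closed by (auto simp: J add_group_simps(3))
    show "a \<otimes> b \<in> J" if "a \<in> J" "b \<in> J" for a b
      using that lam_J[of a b] plus_H
      by (simp add: J mult_eq_sadd_lam sadd_one_sadd sadd_closed)
    show "inv a \<in> J" if a: "a \<in> J" for a
    proof -
      from a have aB: "a \<in> carrier B" by (simp add: J)
      define x where "x = lam (inv a) a"
      have x: "x \<in> carrier B" "x \<oplus> \<one> \<in> H"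
        using lam_J[of "inv a" a] a aB by (simp_all add: J x_def)
      \<comment> \<open>Project \<open>0 = a\<^sup>- \<circ> a = a\<^sup>- + \<lambda>(a)\<close> to \<open>G\<close>: the projection of \<open>a\<^sup>-\<close> is the negative
        of an element of \<open>H\<close>.\<close>
      have "inv a \<oplus> x = \<one>"
        using mult_eq_sadd_lam[of "inv a" a] aB by (simp add: x_def)
      then have "(inv a \<oplus> \<one>) \<oplus> (x \<oplus> \<one>) = \<one>"
        using sadd_one_sadd[of "inv a" x] aB x(1) by simp
      then have "inv a \<oplus> \<one> = inv\<^bsub>add_group B\<^esub> (x \<oplus> \<one>)"
        using aB x(1)
        by (intro G.inv_equality[symmetric])
          (auto simp: add_group_simps)
      then show ?thesis
        using H.m_inv_closed[OF x(2)] aB by (simp add: J)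
    qed
  qed
  moreover have "set_sadd B J {\<one>} \<subseteq> J"
    by (auto simp: set_sadd_def J sadd_closed sadd_assoc)
  moreover have "lam g ` J \<subseteq> J" if "g \<in> carrier (add_group B)" for g
    using that lam_J by (auto simp: carrier_add_group_iff)
  ultimately show ?thesis
    using H J_G by (auto simp: left_ideal_def J)
qed

lemma subgroup_set_dot:
  assumes "I \<subseteq> carrier B"
  shows "subgroup (set_dot B (carrier B) I) (add_group B)"
  unfolding set_dot_def
  using assms by (intro group.generate_is_subgroup[OF group_add_group])
    (auto intro: sb_dot_in_add_group)

lemma set_dot_mono:
  assumes "I \<subseteq> I'"
  shows "set_dot B X I \<subseteq> set_dot B X I'"
  unfolding set_dot_def
  using assms by (intro group.mono_generate[OF group_add_group]) blast

lemma left_series_subset_carrier: "left_series B n \<subseteq> carrier B"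
proof (induction n)
  case (Suc n)
  then show ?case
    using set_sadd_idem_eq[OF subgroup_set_dot[OF Suc.IH]] by (cases n) auto
qed simp

lemma left_series_decreasing: "left_series B (Suc (Suc n)) \<subseteq> left_series B (Suc n)"
proof (induction n)
  case 0
  then show ?case
    using left_series_subset_carrier[of "Suc (Suc 0)"] by simp
next
  case (Suc n)
  show ?case
    using set_dot_mono[OF Suc.IH, of "carrier B"]
    unfolding left_series.simps(3)[of B "Suc n"] left_series.simps(3)[of B n]
    by (auto simp: set_sadd_def)
qed

lemma left_ideal_carrier: "left_ideal B (carrier B)"
proof (rule left_ideal_preimage)
  show "subgroup (carrier (add_group B)) (add_group B)"
    by (rule group.subgroup_self[OF group_add_group])
  show "carrier B = {b \<in> carrier B. b \<oplus> \<one> \<in> carrier (add_group B)}"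
    by (auto simp: add_group_simps(1))
qed (rule sb_dot_in_add_group)

lemma left_ideal_left_series_Suc_Suc: "left_ideal B (left_series B (Suc (Suc n)))"
proof (rule left_ideal_preimage)
  let ?I = "left_series B (Suc n)"
  show H: "subgroup (set_dot B (carrier B) ?I) (add_group B)"
    by (rule subgroup_set_dot[OF left_series_subset_carrier])
  show "left_series B (Suc (Suc n)) =
      {b \<in> carrier B. b \<oplus> \<one> \<in> set_dot B (carrier B) ?I}"
    using set_sadd_idem_eq[OF H] by simp
  show "sb_dot B a b \<in> set_dot B (carrier B) ?I"
    if "a \<in> carrier B" "b \<in> left_series B (Suc (Suc n))" for a b
    using that left_series_decreasing[of n] unfolding set_dot_def
    by (intro generate.incl) blast
qed

end

theorem proposition41:
  fixes B :: "('a, 'b) semi_brace_scheme" and n :: nat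
  assumes "left_semi_brace B" and "n \<ge> 1"
  shows "left_ideal B (left_series B n)"
proof -
  interpret left_semi_brace B
    by (rule assms(1))
  show ?thesis
    using assms(2) left_ideal_carrier left_ideal_left_series_Suc_Suc
    by (cases "(B, n)" rule: left_series.cases) auto
qed

end
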